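(* For every integer $k \geq 1$, \[ \left| \frac{\pi}{4} - GLS_k \right| < \frac{1}{16} \left( \frac{1}{2k+9} - \frac{8}{2k+8} + \frac{27}{2k+7} - \frac{48}{2k+6} + \frac{43}{2k+5} - \frac{8}{2k+4} - \frac{15}{2k+3} + \frac{16}{2k+1} \right) \] \[ = \frac{16k^7+344k^6+3132k^5+15678k^4+46730k^3+83320k^2+82854k+35631}{64k^8+1376k^7+12544k^6+63056k^5+190036k^4+348614k^3+375066k^2+211284k+45360} \] and \[ \left| \frac{\pi}{4} - GLS_k \right| > \frac{1}{16} \left( -\frac{1}{2k+7} + \frac{8}{2k+6} - \frac{27}{2k+5} + \frac{48}{2k+4} - \frac{43}{2k+3} + \frac{8}{2k+2} + \frac{15}{2k+1} \right) \] \[ = \frac{8k^6+112k^5+642k^4+1932k^3+3226k^2+2828k+981}{32k^7+448k^6+2576k^5+7840k^4+13538k^3+13132k^2+6534k+1260}. \]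
   Context: For an integer $k \geq 1$, $GLS_k$ denotes the $k$th partial sum of the Gregory-Leibniz series, $GLS_k := \sum_{i=1}^{k} (-1)^{i+1} \frac{1}{2i-1}$. *)

theory Defs
  imports "HOL-Analysis.Analysis"
begin

definition GLS :: "nat \<Rightarrow> real" where
  "GLS k = (\<Sum>i=1..k. (-1) ^ (i + 1) * (1 / (2 * real i - 1)))"

end

theory Submission
  imports Defs
begin

text \<open>
  Since \<open>(-1)^k (\<pi>/4 - GLS k)\<close> is the integral of \<open>x^(2k) / (1 + x^2)\<close> over the unit interval, any
  polynomial bound for \<open>1 / (1 + x^2)\<close> integrates to a bound for the error. The two bounds come from
  dividing \<open>(1 - x)^8\<close> and \<open>x^2 (1 - x)^8\<close> by \<open>1 + x^2\<close>: the remainders are the constants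
  \<open>16\<close> and \<open>-16\<close>, and the quotients, divided by \<open>16\<close>, are up to sign the polynomials whose moments
  appear in the statement.
\<close>

definition leibniz_tail :: "nat \<Rightarrow> real" where
  "leibniz_tail k = integral {0..1} (\<lambda>x. x ^ (2 * k) / (1 + x\<^sup>2))"

lemma one_plus_square_neq_0: "1 + x\<^sup>2 \<noteq> (0::real)"
  by (metis power_one sum_power2_eq_zero_iff zero_neq_one)

lemma continuous_on_over_one_plus_square:
  fixes f :: "real \<Rightarrow> real"
  assumes "continuous_on S f"
  shows "continuous_on S (\<lambda>x. f x / (1 + x\<^sup>2))"
  by (intro continuous_intros assms ballI one_plus_square_neq_0)

lemma leibniz_tail_has_integral:
  "((\<lambda>x. x ^ (2 * k) / (1 + x\<^sup>2)) has_integral leibniz_tail k) {0..1}"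
  unfolding leibniz_tail_def
  by (intro integrable_integral integrable_continuous_real continuous_on_over_one_plus_square
      continuous_intros)

lemma power_has_integral_unit: "((\<lambda>x::real. x ^ n) has_integral 1 / real (Suc n)) {0..1}"
proof -
  have "((\<lambda>x::real. x ^ n) has_integral (1 ^ Suc n / real (Suc n) - 0 ^ Suc n / real (Suc n))) {0..1}"
    by (rule fundamental_theorem_of_calculus)
      (auto intro!: derivative_eq_intros simp del: power_Suc of_nat_Suc simp flip: has_real_derivative_iff_has_vector_derivative)
  then show ?thesis by simp
qed

lemma leibniz_tail_0: "leibniz_tail 0 = pi / 4"
proof -
  have "((\<lambda>x::real. 1 / (1 + x\<^sup>2)) has_integral (arctan 1 - arctan 0)) {0..1}"
    by (rule fundamental_theorem_of_calculus)
      (auto intro!: derivative_eq_intros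
        simp: inverse_eq_divide simp flip: has_real_derivative_iff_has_vector_derivative)
  then show ?thesis
    by (simp add: leibniz_tail_def integral_unique arctan_one)
qed

text \<open>Over the common denominator the two integrands add up to
  \<open>x ^ (2 * k) * (1 + x\<^sup>2) / (1 + x\<^sup>2)\<close>, so the denominator cancels and
  only a power is left to integrate.\<close>

lemma leibniz_tail_Suc: "leibniz_tail k + leibniz_tail (Suc k) = 1 / (2 * real k + 1)"
proof -
  have eq: "x ^ (2 * k) / (1 + x\<^sup>2) + x ^ (2 * Suc k) / (1 + x\<^sup>2) = x ^ (2 * k)" for x :: real
  proof -
    have "x ^ (2 * k) / (1 + x\<^sup>2) + x ^ (2 * Suc k) / (1 + x\<^sup>2) = x ^ (2 * k) * (1 + x\<^sup>2) / (1 + x\<^sup>2)"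
      by (simp add: add_divide_distrib[symmetric] distrib_left power_add power2_eq_square)
    with one_plus_square_neq_0[of x] show ?thesis by simp
  qed
  have "((\<lambda>x::real. x ^ (2 * k)) has_integral (leibniz_tail k + leibniz_tail (Suc k))) {0..1}"
    using has_integral_add[OF leibniz_tail_has_integral[of k] leibniz_tail_has_integral[of "Suc k"]]
    unfolding eq .
  from has_integral_unique[OF this power_has_integral_unit] show ?thesis
    by (simp add: add.commute)
qed

text \<open>The recurrence writes each new term of the series as a sum of two consecutive tails with
  the same sign, so the sum telescopes. The empty sum at \<open>k = 0\<close> leaves the arctangent
  integral pi/4.\<close>

lemma GLS_error: "pi / 4 - GLS k = (-1) ^ k * leibniz_tail k"
proof (induction k)
  case 0
  show ?case by (simp add: GLS_def leibniz_tail_0)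
next
  case (Suc k)
  have "GLS (Suc k) = GLS k + (-1) ^ k * (1 / (2 * real k + 1))"
    by (simp add: GLS_def)
  also have "1 / (2 * real k + 1) = leibniz_tail k + leibniz_tail (Suc k)"
    by (rule leibniz_tail_Suc[symmetric])
  finally show ?case
    using Suc.IH by (simp add: algebra_simps)
qed

text \<open>A nonnegative continuous function with integral 0 vanishes everywhere, which positivity
  inside the interval excludes. The endpoints get a weaker condition because the integrands below
  may vanish there.\<close>

lemma has_integral_unit_pos:
  fixes f :: "real \<Rightarrow> real"
  assumes int: "(f has_integral I) {0..1}" and cont: "continuous_on {0..1} f"
    and pos: "\<And>x. 0 < x \<Longrightarrow> x < 1 \<Longrightarrow> 0 < f x"
    and nonneg: "0 \<le> f 0" "0 \<le> f 1"
  shows "0 < I"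
proof -
  have nn: "0 \<le> f x" if "x \<in> {0..1}" for x
    using that nonneg pos[of x] by (cases "x = 0 \<or> x = 1") auto
  have "I \<ge> 0"
    using has_integral_nonneg[OF int] nn by blast
  moreover have "I \<noteq> 0"
  proof
    assume "I = 0"
    then have "f (1 / 2) = 0"
      using has_integral_0_cbox_imp_0[of 0 1 f "1 / 2"] cont nn int by simp
    with pos[of "1 / 2"] show False by simp
  qed
  ultimately show ?thesis by simp
qed

text \<open>Both bounds differ from \<open>16 * leibniz_tail k\<close> by an integral of this shape,
  with \<open>n = 2 * k + 2\<close> for the upper and \<open>n = 2 * k\<close> for the lower one.
  This makes both inequalities strict.\<close>

lemma power_weight_tail_pos:
  assumes "((\<lambda>x. x ^ n * (1 - x) ^ 8 / (1 + x\<^sup>2)) has_integral I) {0..1::real}"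
  shows "0 < I"
proof (rule has_integral_unit_pos[OF assms])
  show "continuous_on {0..1} (\<lambda>x::real. x ^ n * (1 - x) ^ 8 / (1 + x\<^sup>2))"
    by (intro continuous_on_over_one_plus_square continuous_intros)
next
  fix x :: real
  assume "0 < x" "x < 1"
  then show "0 < x ^ n * (1 - x) ^ 8 / (1 + x\<^sup>2)"
    by (intro divide_pos_pos mult_pos_pos zero_less_power) (auto intro: add_pos_pos)
qed auto

lemma leibniz_tail_pos: "0 < leibniz_tail k"
proof (rule has_integral_unit_pos[OF leibniz_tail_has_integral])
  show "continuous_on {0..1} (\<lambda>x::real. x ^ (2 * k) / (1 + x\<^sup>2))"
    by (intro continuous_on_over_one_plus_square continuous_intros)
next
  fix x :: real
  assume "0 < x" "x < 1"
  then show "0 < x ^ (2 * k) / (1 + x\<^sup>2)"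
    by (intro divide_pos_pos) (auto intro: add_pos_pos)
qed auto

text \<open>Positivity of the tail strips off the alternating sign, so the parity of
  \<open>k\<close> no longer matters and a single integral has to be bounded.\<close>

lemma abs_GLS_error: "\<bar>pi / 4 - GLS k\<bar> = leibniz_tail k"
  using leibniz_tail_pos[of k] by (simp add: GLS_error abs_mult power_abs)

lemma shifted_power_has_integral_unit:
  "((\<lambda>x::real. c * x ^ (2 * k + j)) has_integral c / (2 * real k + real (Suc j))) {0..1}"
  using has_integral_mult_right[OF power_has_integral_unit[of "2 * k + j"], of c]
  by (simp add: add_ac)

lemma leibniz_tail_upper:
  "16 * leibniz_tail k <
    1 / (2 * real k + 9) - 8 / (2 * real k + 8) + 27 / (2 * real k + 7)
    - 48 / (2 * real k + 6) + 43 / (2 * real k + 5) - 8 / (2 * real k + 4)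
    - 15 / (2 * real k + 3) + 16 / (2 * real k + 1)"
    (is "_ < ?U")
proof -
  \<comment> \<open>This is \<open>x ^ (2 * k)\<close> times the quotient of
    \<open>x\<^sup>2 * (1 - x) ^ 8\<close> by \<open>1 + x\<^sup>2\<close>. The remainder is -16,
    the value of the dividend at the imaginary unit i, since (1 - i)^8 = 16. The coefficient
    \<open>1\<close> and the exponent \<open>2 * k + 0\<close> are spelled out so that each monomial
    matches \<open>shifted_power_has_integral_unit\<close>.\<close>
  let ?p = "\<lambda>x::real. 1 * x ^ (2 * k + 8) - 8 * x ^ (2 * k + 7) + 27 * x ^ (2 * k + 6)
    - 48 * x ^ (2 * k + 5) + 43 * x ^ (2 * k + 4) - 8 * x ^ (2 * k + 3)
    - 15 * x ^ (2 * k + 2) + 16 * x ^ (2 * k + 0)"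
  have "(?p has_integral
    1 / (2 * real k + real (Suc 8)) - 8 / (2 * real k + real (Suc 7))
    + 27 / (2 * real k + real (Suc 6)) - 48 / (2 * real k + real (Suc 5))
    + 43 / (2 * real k + real (Suc 4)) - 8 / (2 * real k + real (Suc 3))
    - 15 / (2 * real k + real (Suc 2)) + 16 / (2 * real k + real (Suc 0))) {0..1}"
    by (intro has_integral_add has_integral_diff shifted_power_has_integral_unit)
  then have p: "(?p has_integral ?U) {0..1}"
    by simp
  have eq: "?p x - 16 * (x ^ (2 * k) / (1 + x\<^sup>2)) = x ^ (2 * k + 2) * (1 - x) ^ 8 / (1 + x\<^sup>2)"
    for x :: real
  proof -
    have "?p x * (1 + x\<^sup>2) - 16 * x ^ (2 * k) = x ^ (2 * k + 2) * (1 - x) ^ 8"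
      \<comment> \<open>Splitting the exponents makes \<open>x ^ (2 * k)\<close> a common factor;
        what remains is the division with remainder, a polynomial identity in
        \<open>x\<close>.\<close>
      unfolding power_add by algebra
    then show ?thesis
      using one_plus_square_neq_0[of x] by (simp add: divide_simps)
  qed
  have "((\<lambda>x. x ^ (2 * k + 2) * (1 - x) ^ 8 / (1 + x\<^sup>2)) has_integral ?U - 16 * leibniz_tail k) {0..1}"
    using has_integral_diff[OF p has_integral_mult_right[OF leibniz_tail_has_integral[of k], of 16]]
    unfolding eq .
  from power_weight_tail_pos[OF this] show ?thesis by simp
qed

lemma leibniz_tail_lower:
  "- (1 / (2 * real k + 7)) + 8 / (2 * real k + 6) - 27 / (2 * real k + 5)
    + 48 / (2 * real k + 4) - 43 / (2 * real k + 3) + 8 / (2 * real k + 2)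
    + 15 / (2 * real k + 1) < 16 * leibniz_tail k"
    (is "?L < _")
proof -
  \<comment> \<open>Dividing \<open>(1 - x) ^ 8\<close> itself by \<open>1 + x\<^sup>2\<close>
    leaves the remainder +16. The opposite sign turns the quotient into a lower bound, so
    \<open>?p\<close> is \<open>x ^ (2 * k)\<close> times the negated quotient.\<close>
  let ?p = "\<lambda>x::real. - (1 * x ^ (2 * k + 6)) + 8 * x ^ (2 * k + 5) - 27 * x ^ (2 * k + 4)
    + 48 * x ^ (2 * k + 3) - 43 * x ^ (2 * k + 2) + 8 * x ^ (2 * k + 1)
    + 15 * x ^ (2 * k + 0)"
  have "(?p has_integral
    - (1 / (2 * real k + real (Suc 6))) + 8 / (2 * real k + real (Suc 5))
    - 27 / (2 * real k + real (Suc 4)) + 48 / (2 * real k + real (Suc 3))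
    - 43 / (2 * real k + real (Suc 2)) + 8 / (2 * real k + real (Suc 1))
    + 15 / (2 * real k + real (Suc 0))) {0..1}"
    by (intro has_integral_add has_integral_diff has_integral_neg shifted_power_has_integral_unit)
  then have p: "(?p has_integral ?L) {0..1}"
    by simp
  have eq: "16 * (x ^ (2 * k) / (1 + x\<^sup>2)) - ?p x = x ^ (2 * k) * (1 - x) ^ 8 / (1 + x\<^sup>2)"
    for x :: real
  proof -
    have "16 * x ^ (2 * k) - ?p x * (1 + x\<^sup>2) = x ^ (2 * k) * (1 - x) ^ 8"
      unfolding power_add by algebra
    then show ?thesis
      using one_plus_square_neq_0[of x] by (simp add: divide_simps)
  qed
  have "((\<lambda>x. x ^ (2 * k) * (1 - x) ^ 8 / (1 + x\<^sup>2)) has_integral 16 * leibniz_tail k - ?L) {0..1}"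
    using has_integral_diff[OF has_integral_mult_right[OF leibniz_tail_has_integral[of k], of 16] p]
    unfolding eq .
  from power_weight_tail_pos[OF this] show ?thesis by simp
qed

lemma upper_bound_as_quotient:
  fixes k :: real
  assumes "0 \<le> k"
  shows "(1 / 16) * (1 / (2 * k + 9) - 8 / (2 * k + 8) + 27 / (2 * k + 7)
          - 48 / (2 * k + 6) + 43 / (2 * k + 5) - 8 / (2 * k + 4)
          - 15 / (2 * k + 3) + 16 / (2 * k + 1))
       = (16 * k ^ 7 + 344 * k ^ 6 + 3132 * k ^ 5 + 15678 * k ^ 4
          + 46730 * k ^ 3 + 83320 * k ^ 2 + 82854 * k + 35631)
         / (64 * k ^ 8 + 1376 * k ^ 7 + 12544 * k ^ 6 + 63056 * k ^ 5
          + 190036 * k ^ 4 + 348614 * k ^ 3 + 375066 * k ^ 2 + 211284 * k + 45360)"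
proof -
  \<comment> \<open>The factors are the eight denominators of the sum, the even ones halved. In this
    form it is visible that no factor vanishes for nonnegative \<open>k\<close>, so the fractions
    can be cleared.\<close>
  have den: "64 * k ^ 8 + 1376 * k ^ 7 + 12544 * k ^ 6 + 63056 * k ^ 5
          + 190036 * k ^ 4 + 348614 * k ^ 3 + 375066 * k ^ 2 + 211284 * k + 45360
    = 2 * ((2 * k + 1) * (2 * k + 3) * (k + 2) * (2 * k + 5) * (k + 3) * (2 * k + 7) * (k + 4) * (2 * k + 9))"
    by algebra
  have even: "2 * k + 8 = 2 * (k + 4)" "2 * k + 6 = 2 * (k + 3)" "2 * k + 4 = 2 * (k + 2)"
    "2 * k + 2 = 2 * (k + 1)"
    by simp_all
  have "2 * k + 1 \<noteq> 0"
    and "2 * k + 3 \<noteq> 0"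
    and "k + 2 \<noteq> 0"
    and "2 * k + 5 \<noteq> 0"
    and "k + 3 \<noteq> 0"
    and "2 * k + 7 \<noteq> 0"
    and "k + 4 \<noteq> 0"
    and "2 * k + 9 \<noteq> 0"
    using assms by simp_all
  then show ?thesis
    unfolding den even by (simp add: divide_simps) algebra
qed

lemma lower_bound_as_quotient:
  fixes k :: real
  assumes "0 \<le> k"
  shows "(1 / 16) * (- (1 / (2 * k + 7)) + 8 / (2 * k + 6) - 27 / (2 * k + 5)
          + 48 / (2 * k + 4) - 43 / (2 * k + 3) + 8 / (2 * k + 2)
          + 15 / (2 * k + 1))
       = (8 * k ^ 6 + 112 * k ^ 5 + 642 * k ^ 4 + 1932 * k ^ 3
          + 3226 * k ^ 2 + 2828 * k + 981)
         / (32 * k ^ 7 + 448 * k ^ 6 + 2576 * k ^ 5 + 7840 * k ^ 4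
          + 13538 * k ^ 3 + 13132 * k ^ 2 + 6534 * k + 1260)"
proof -
  \<comment> \<open>Again the product of the denominators, here seven, with the even ones
    halved.\<close>
  have den: "32 * k ^ 7 + 448 * k ^ 6 + 2576 * k ^ 5 + 7840 * k ^ 4
          + 13538 * k ^ 3 + 13132 * k ^ 2 + 6534 * k + 1260
    = 2 * ((2 * k + 1) * (k + 1) * (2 * k + 3) * (k + 2) * (2 * k + 5) * (k + 3) * (2 * k + 7))"
    by algebra
  have even: "2 * k + 8 = 2 * (k + 4)" "2 * k + 6 = 2 * (k + 3)" "2 * k + 4 = 2 * (k + 2)"
    "2 * k + 2 = 2 * (k + 1)"
    by simp_all
  have "2 * k + 1 \<noteq> 0"
    and "k + 1 \<noteq> 0"
    and "2 * k + 3 \<noteq> 0"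
    and "k + 2 \<noteq> 0"
    and "2 * k + 5 \<noteq> 0"
    and "k + 3 \<noteq> 0"
    and "2 * k + 7 \<noteq> 0"
    using assms by simp_all
  then show ?thesis
    unfolding den even by (simp add: divide_simps) algebra
qed

theorem proposition4:
  fixes k :: nat
  assumes "k \<ge> 1"
  shows "\<bar>pi / 4 - GLS k\<bar>
       < (1 / 16) * (1 / (2 * real k + 9) - 8 / (2 * real k + 8) + 27 / (2 * real k + 7)
          - 48 / (2 * real k + 6) + 43 / (2 * real k + 5) - 8 / (2 * real k + 4)
          - 15 / (2 * real k + 3) + 16 / (2 * real k + 1))
    \<and> (1 / 16) * (1 / (2 * real k + 9) - 8 / (2 * real k + 8) + 27 / (2 * real k + 7)
          - 48 / (2 * real k + 6) + 43 / (2 * real k + 5) - 8 / (2 * real k + 4)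
          - 15 / (2 * real k + 3) + 16 / (2 * real k + 1))
       = (16 * real k ^ 7 + 344 * real k ^ 6 + 3132 * real k ^ 5 + 15678 * real k ^ 4
          + 46730 * real k ^ 3 + 83320 * real k ^ 2 + 82854 * real k + 35631)
         / (64 * real k ^ 8 + 1376 * real k ^ 7 + 12544 * real k ^ 6 + 63056 * real k ^ 5
          + 190036 * real k ^ 4 + 348614 * real k ^ 3 + 375066 * real k ^ 2 + 211284 * real k + 45360)
    \<and> \<bar>pi / 4 - GLS k\<bar>
       > (1 / 16) * (- (1 / (2 * real k + 7)) + 8 / (2 * real k + 6) - 27 / (2 * real k + 5)
          + 48 / (2 * real k + 4) - 43 / (2 * real k + 3) + 8 / (2 * real k + 2)
          + 15 / (2 * real k + 1))
    \<and> (1 / 16) * (- (1 / (2 * real k + 7)) + 8 / (2 * real k + 6) - 27 / (2 * real k + 5)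
          + 48 / (2 * real k + 4) - 43 / (2 * real k + 3) + 8 / (2 * real k + 2)
          + 15 / (2 * real k + 1))
       = (8 * real k ^ 6 + 112 * real k ^ 5 + 642 * real k ^ 4 + 1932 * real k ^ 3
          + 3226 * real k ^ 2 + 2828 * real k + 981)
         / (32 * real k ^ 7 + 448 * real k ^ 6 + 2576 * real k ^ 5 + 7840 * real k ^ 4
          + 13538 * real k ^ 3 + 13132 * real k ^ 2 + 6534 * real k + 1260)"
  unfolding abs_GLS_error
  using leibniz_tail_upper[of k] leibniz_tail_lower[of k]
  by (intro conjI upper_bound_as_quotient lower_bound_as_quotient) simp_all

end
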